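(* Let $\alpha,\gamma\in\mathbb{C}$ be such that $\alpha,\ \gamma,\ \gamma-\alpha\notin\mathbb{Z}_{\le 0}$, and let ${}_1F_1(\alpha;\gamma;z)=\sum_{n=0}^{\infty}\frac{(\alpha)_n}{n!\,(\gamma)_n}z^n$ be the confluent hypergeometric function. If $\{z_n\}_{n\ge 1}$ is the sequence of zeros of ${}_1F_1(\alpha;\gamma;z)$ in $\mathbb{C}$, with multiple zeros repeated according to multiplicity and arranged so that $|z_1|\le |z_2|\le\cdots\le|z_n|\le\cdots$, then there exists a constant $M>0$ such that $|z_n|\ge Mn$ for all $n\ge 1$.
   Context: Here $\mathbb{Z}_{\le 0}=\{0,-1,-2,\dots\}$ and $(\alpha)_n:=\alpha(\alpha+1)\cdots(\alpha+n-1)$ is the rising factorial, with $(\alpha)_0=1$. For $\gamma\notin\mathbb{Z}_{\le 0}$ the series defining ${}_1F_1(\alpha;\gamma;z)$ converges for every $z\in\mathbb{C}$ and defines an entire function of $z$. When $\alpha,\gamma,\gamma-\alpha\notin\mathbb{Z}_{\le 0}$, this function has infinitely many zeros in $\mathbb{C}$ (known fact), so the zero sequence is infinite. The parameters $\alpha,\gamma$ are fixed, and the constant $M$ may depend on them but not on $n$. *)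

theory Defs
  imports "HOL-Complex_Analysis.Complex_Analysis"
begin

definition hypergeometric_1F1 :: "complex \<Rightarrow> complex \<Rightarrow> complex \<Rightarrow> complex" where
  "hypergeometric_1F1 \<alpha> \<gamma> z =
     (\<Sum>n. pochhammer \<alpha> n / (fact n * pochhammer \<gamma> n) * z ^ n)"

text \<open>
  Sequences are indexed from 1, so the value of \<open>z\<close> at 0 is irrelevant.
  \<open>zorder f w\<close> is the multiplicity of the zero \<open>w\<close>, a positive integer as soon as the entire
  function \<open>f\<close> is not identically zero; the set of indices in the third conjunct is then
  nonempty and finite.
\<close>
definition zero_sequence :: "(complex \<Rightarrow> complex) \<Rightarrow> (nat \<Rightarrow> complex) \<Rightarrow> bool" where
  "zero_sequence f z \<longleftrightarrow>
     (\<forall>n\<ge>1. norm (z n) \<le> norm (z (Suc n))) \<and>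
     (\<forall>n\<ge>1. f (z n) = 0) \<and>
     (\<forall>w. f w = 0 \<longrightarrow> int (card {n. n \<ge> 1 \<and> z n = w}) = zorder f w)"

end

theory Submission
  imports Defs
begin

text \<open>
  The quotients \<open>(\<alpha> + k) / (\<gamma> + k)\<close> are bounded, by \<open>K\<close> say, so the function \<open>f\<close> is entire and
  \<open>\<bar>f z\<bar> \<le> exp (K \<bar>z\<bar>)\<close>. As \<open>f 0 = 1\<close>, one may divide \<open>f\<close> by the product of the factors
  \<open>1 - z / z\<^sub>i\<close> for \<open>i \<le> n\<close>. On the circle of radius \<open>3 \<bar>z\<^sub>n\<bar>\<close> each factor is at least 2 in modulus,
  so the maximum principle, applied to the quotient at 0, gives \<open>2\<^sup>n \<le> exp (3 K \<bar>z\<^sub>n\<bar>)\<close>.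
\<close>

text \<open>The ratio of Pochhammer symbols is the product of the first \<open>n\<close> quotients
  (\<alpha> + k) / (\<gamma> + k). These converge to 1, hence are bounded, and a common bound yields
  a geometric one.\<close>

lemma pochhammer_ratio_bound:
  fixes \<alpha> \<gamma> :: complex
  assumes "\<gamma> \<notin> \<int>\<^sub>\<le>\<^sub>0"
  obtains K where "K > 0" "\<And>n. norm (pochhammer \<alpha> n / pochhammer \<gamma> n) \<le> K ^ n"
proof -
  have "(\<lambda>k. (\<alpha> + of_nat k) / (\<gamma> + of_nat k)) \<longlonglongrightarrow> 1"
  proof -
    have "(\<lambda>k. 1 + (\<alpha> - \<gamma>) / (\<gamma> + of_nat k)) \<longlonglongrightarrow> 1 + 0"
      by (intro tendsto_intros tendsto_divide_0[OF tendsto_const]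
            tendsto_add_filterlim_at_infinity[OF tendsto_const] tendsto_of_nat)
    moreover have "\<gamma> + of_nat k \<noteq> 0" for k
      using assms plus_of_nat_eq_0_imp by blast
    hence "1 + (\<alpha> - \<gamma>) / (\<gamma> + of_nat k) = (\<alpha> + of_nat k) / (\<gamma> + of_nat k)" for k
      by (simp add: field_simps)
    ultimately show ?thesis by simp
  qed
  hence "Bseq (\<lambda>k. (\<alpha> + of_nat k) / (\<gamma> + of_nat k))"
    by (intro convergent_imp_Bseq convergentI)
  then obtain K where K: "K > 0" "\<And>k. norm ((\<alpha> + of_nat k) / (\<gamma> + of_nat k)) \<le> K"
    by (auto simp: Bseq_def)
  have "norm (pochhammer \<alpha> n / pochhammer \<gamma> n) \<le> K ^ n" for n
  proof (induction n)
    case (Suc n)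
    have "norm (pochhammer \<alpha> n / pochhammer \<gamma> n * ((\<alpha> + of_nat n) / (\<gamma> + of_nat n))) \<le> K ^ n * K"
      unfolding norm_mult using Suc K by (intro mult_mono) auto
    thus ?case by (simp add: pochhammer_Suc mult.commute)
  qed simp
  with K show ?thesis using that by blast
qed

lemma hypergeometric_1F1_at_0: "hypergeometric_1F1 \<alpha> \<gamma> 0 = 1"
  unfolding hypergeometric_1F1_def by (subst powser_zero) simp

text \<open>With the geometric bound on the coefficients, the series is dominated term by term by
  that of \<open>exp (K * norm z)\<close>. This gives convergence everywhere and the growth estimate
  at once.\<close>

lemma hypergeometric_1F1_exponential_type:
  assumes "\<gamma> \<notin> \<int>\<^sub>\<le>\<^sub>0"
  obtains K where "K > 0" "\<And>z. norm (hypergeometric_1F1 \<alpha> \<gamma> z) \<le> exp (K * norm z)"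
    "hypergeometric_1F1 \<alpha> \<gamma> holomorphic_on UNIV"
proof -
  obtain K where K: "K > 0" "\<And>n. norm (pochhammer \<alpha> n / pochhammer \<gamma> n) \<le> K ^ n"
    using pochhammer_ratio_bound[OF assms] by blast
  let ?a = "\<lambda>n. pochhammer \<alpha> n / (fact n * pochhammer \<gamma> n)"
  have bound: "norm (?a n * z ^ n) \<le> (K * norm z) ^ n /\<^sub>R fact n" for n z
  proof -
    have "norm (?a n * z ^ n) = norm (pochhammer \<alpha> n / pochhammer \<gamma> n) * (norm z ^ n / fact n)"
      by (simp add: norm_mult norm_divide norm_power)
    also have "\<dots> \<le> K ^ n * (norm z ^ n / fact n)"
      using K(2) by (intro mult_right_mono) auto
    finally show ?thesis by (simp add: power_mult_distrib field_simps)
  qed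
  have sums: "(\<lambda>n. ?a n * z ^ n) sums hypergeometric_1F1 \<alpha> \<gamma> z" for z
    unfolding hypergeometric_1F1_def
    by (rule summable_sums, rule summable_comparison_test'[OF summable_exp_generic bound])
  have norm_le: "norm (hypergeometric_1F1 \<alpha> \<gamma> z) \<le> exp (K * norm z)" for z
    unfolding hypergeometric_1F1_def exp_def
    by (rule norm_suminf_le[OF bound summable_exp_generic])
  have "hypergeometric_1F1 \<alpha> \<gamma> holomorphic_on ball 0 r" for r
    by (rule power_series_holomorphic[where a = ?a]) (use sums in \<open>simp only: diff_zero\<close>)
  hence "hypergeometric_1F1 \<alpha> \<gamma> field_differentiable (at z)" for z
    by (rule holomorphic_on_imp_differentiable_at[where s = "ball 0 (norm z + 1)"]) auto
  hence "hypergeometric_1F1 \<alpha> \<gamma> holomorphic_on UNIV"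
    by (simp add: holomorphic_on_def)
  with K norm_le show ?thesis using that by blast
qed

text \<open>Zeros are divided out one at a time. Multiplicity is what keeps this going: the next
  zero must still be a zero of the current quotient \<open>g\<close>.\<close>

lemma zero_sequence_factor:
  assumes f: "f holomorphic_on UNIV" "f 0 \<noteq> 0" and z: "zero_sequence f z"
  shows "\<exists>g. g holomorphic_on UNIV \<and> (\<forall>x. f x = g x * (\<Prod>i\<in>{1..n}. 1 - x / z i))"
proof (induction n)
  case 0
  thus ?case using f by auto
next
  case (Suc n)
  then obtain g where g: "g holomorphic_on UNIV" "\<And>x. f x = g x * (\<Prod>i\<in>{1..n}. 1 - x / z i)"
    by blast
  have z0: "f (z i) = 0" "z i \<noteq> 0" if "i \<ge> 1" for i
    using z f(2) that unfolding zero_sequence_def by metis+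
  define w where "w = z (Suc n)"
  have w: "f w = 0" "w \<noteq> 0" using z0[of "Suc n"] by (auto simp: w_def)
  have "g w = 0"
  \<comment> \<open>If \<open>g w\<close> were nonzero, the order of \<open>f\<close> at
    \<open>w\<close> would be the number of indices up to \<open>n\<close> with value
    \<open>w\<close>; but index \<open>Suc n\<close> also has this value, one more than the order
    allows.\<close>
  proof (rule ccontr)
    assume gw: "g w \<noteq> 0"
    define A where "A = {i\<in>{1..n}. z i = w}"
    define B where "B = {i\<in>{1..n}. z i \<noteq> w}"
    \<comment> \<open>\<open>h\<close> collects everything that does not vanish at \<open>w\<close>;
      its constant comes from 1 - x/w = (-1/w)(x - w).\<close>
    define h where "h = (\<lambda>x. g x * (\<Prod>i\<in>B. 1 - x / z i) * (-1 / w) ^ card A)"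
    have AB: "{1..n} = A \<union> B" "A \<inter> B = {}" "finite A" "finite B"
      by (auto simp: A_def B_def)
    have "(\<Prod>i\<in>A. 1 - x / z i) = (-1 / w) ^ card A * (x - w) ^ card A" for x
    proof -
      have "(\<Prod>i\<in>A. 1 - x / z i) = (\<Prod>i\<in>A. (-1 / w) * (x - w))"
        using w by (intro prod.cong) (auto simp: A_def field_simps)
      thus ?thesis by (simp only: prod_constant power_mult_distrib)
    qed
    hence "f x = h x * (x - w) powi int (card A)" for x
      unfolding g(2) AB(1) prod.union_disjoint[OF AB(3,4,2)] by (simp add: h_def)
    moreover have "h holomorphic_on UNIV"
      unfolding h_def by (intro holomorphic_intros g) (auto simp: B_def intro!: z0)
    moreover have "h w \<noteq> 0"
      using gw w z0 by (auto simp: h_def B_def)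
    ultimately have "zorder f w = int (card A)"
      by (intro zorder_eqI[where S = UNIV and g = h]) auto
    hence card: "card {k. k \<ge> 1 \<and> z k = w} = card A"
      using z w unfolding zero_sequence_def by fastforce
    \<comment> \<open>An infinite set has \<open>card\<close> 0, so the equality of cardinalities
      implies finiteness only once \<open>card A\<close> is known to be positive.\<close>
    have "A \<noteq> {}"
    proof
      assume "A = {}"
      hence "f w = g w * (\<Prod>i\<in>B. 1 - w / z i)" using g(2) AB(1) by simp
      moreover have "(\<Prod>i\<in>B. 1 - w / z i) \<noteq> 0" using z0 by (auto simp: B_def)
      ultimately show False using gw w by simp
    qed
    hence "finite {k. k \<ge> 1 \<and> z k = w}"
      using card AB(3) by (metis card_0_eq card.infinite)
    hence "card (insert (Suc n) A) \<le> card {k. k \<ge> 1 \<and> z k = w}"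
      by (intro card_mono) (auto simp: A_def w_def)
    moreover have "Suc n \<notin> A" by (auto simp: A_def)
    ultimately show False using card AB(3) by simp
  qed
  \<comment> \<open>The difference quotient at the zero \<open>w\<close>, with its removable
    singularity filled by the derivative.\<close>
  define g' where "g' = (\<lambda>x. if x = w then deriv g w else (g x - g w) / (x - w))"
  have "g' holomorphic_on UNIV"
    unfolding g'_def by (rule pole_lemma[OF g(1)]) auto
  hence "(\<lambda>x. - w * g' x) holomorphic_on UNIV" by (intro holomorphic_intros)
  moreover have "g x = - w * g' x * (1 - x / w)" for x
    using \<open>g w = 0\<close> w by (auto simp: g'_def field_simps)
  hence "f x = - w * g' x * (\<Prod>i\<in>{1..Suc n}. 1 - x / z i)" for x
    by (simp add: g(2) w_def)
  ultimately show ?case by blast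
qed

lemma zero_sequence_jensen_bound:
  assumes f: "f holomorphic_on UNIV" "f 0 = 1" and z: "zero_sequence f z" and n: "n \<ge> 1"
    and B: "\<And>x. norm x = 3 * norm (z n) \<Longrightarrow> norm (f x) \<le> B"
  shows "2 ^ n \<le> B"
proof -
  obtain g where g: "g holomorphic_on UNIV" "\<And>x. f x = g x * (\<Prod>i\<in>{1..n}. 1 - x / z i)"
    using zero_sequence_factor[OF f(1) _ z, of n] f(2) by auto
  have z0: "z i \<noteq> 0" if "i \<ge> 1" for i
    using z f(2) that unfolding zero_sequence_def by (metis one_neq_zero)
  have mono: "norm (z i) \<le> norm (z n)" if "i \<in> {1..n}" for i
  proof -
    have "i \<le> n" using that by simp
    thus ?thesis
      by (induction rule: dec_induct) (use z that in \<open>auto simp: zero_sequence_def intro: order_trans\<close>)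
  qed
  have "norm (g x) \<le> B / 2 ^ n" if x: "norm x = 3 * norm (z n)" for x
  proof -
    have "2 ^ n \<le> (\<Prod>i\<in>{1..n}. norm (1 - x / z i))"
    proof -
      have "2 \<le> norm (1 - x / z i)" if i: "i \<in> {1..n}" for i
      proof -
        \<comment> \<open>The radius factor 3 is chosen so that the reverse triangle inequality
          leaves 3 - 1 = 2.\<close>
        have "3 \<le> norm (x / z i)"
          using mono[OF i] z0[of i] i x by (simp add: norm_divide field_simps)
        thus ?thesis using norm_triangle_ineq2[of "x / z i" 1] by (simp add: norm_minus_commute)
      qed
      hence "(\<Prod>i\<in>{1..n}. 2) \<le> (\<Prod>i\<in>{1..n}. norm (1 - x / z i))"
        by (intro prod_mono) auto
      thus ?thesis by simp
    qed
    hence "norm (g x) * 2 ^ n \<le> norm (f x)"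
      by (simp add: g(2) norm_mult prod_norm mult_left_mono)
    also have "\<dots> \<le> B" by (rule B[OF x])
    finally show ?thesis by (simp add: field_simps)
  qed
  \<comment> \<open>Cauchy's inequality for the derivative of order 0 serves as the maximum
    principle at the centre.\<close>
  hence "norm ((deriv ^^ 0) g 0) \<le> fact 0 * (B / 2 ^ n) / (3 * norm (z n)) ^ 0"
    using g(1) z0[OF n]
    by (intro Cauchy_inequality)
       (auto intro: holomorphic_on_subset holomorphic_on_imp_continuous_on)
  moreover have "g 0 = 1" using g(2)[of 0] f(2) by simp
  ultimately show ?thesis by (simp add: field_simps)
qed

theorem theorem1p3:
  fixes \<alpha> \<gamma> :: complex and z :: "nat \<Rightarrow> complex"
  assumes "\<alpha> \<notin> \<int>\<^sub>\<le>\<^sub>0" and "\<gamma> \<notin> \<int>\<^sub>\<le>\<^sub>0" and "\<gamma> - \<alpha> \<notin> \<int>\<^sub>\<le>\<^sub>0"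
    and "zero_sequence (hypergeometric_1F1 \<alpha> \<gamma>) z"
  shows "\<exists>M::real. M > 0 \<and> (\<forall>n\<ge>1. norm (z n) \<ge> M * real n)"
proof -
  obtain K where K: "K > 0" "\<And>z. norm (hypergeometric_1F1 \<alpha> \<gamma> z) \<le> exp (K * norm z)"
    and hol: "hypergeometric_1F1 \<alpha> \<gamma> holomorphic_on UNIV"
    using hypergeometric_1F1_exponential_type[OF assms(2)] by metis
  \<comment> \<open>The constant results from taking logarithms in 2^n \<le> exp (3 K
    |z_n|).\<close>
  have "ln 2 / (3 * K) * real n \<le> norm (z n)" if "n \<ge> 1" for n
  proof -
    have "2 ^ n \<le> exp (K * (3 * norm (z n)))"
      using zero_sequence_jensen_bound[OF hol hypergeometric_1F1_at_0 assms(4) that] K(2) by metis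
    hence "ln (2 ^ n) \<le> K * (3 * norm (z n))"
      by (subst ln_exp[symmetric], subst ln_le_cancel_iff) auto
    thus ?thesis using K(1) by (simp add: ln_realpow field_simps)
  qed
  thus ?thesis using K(1) by (intro exI[of _ "ln 2 / (3 * K)"]) auto
qed

end
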